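(* Let $\alpha\in(0,1)$ and let $X$ and $Y$ be (integrable, real-valued) random variables with CDFs $F_X,F_Y$. Let $g:\mathbb{R}\to[0,\infty)$ be right-continuous and monotonically increasing (non-decreasing) with $\lim_{x\to-\infty}g(x)=0$, and suppose $F_X(x)\le F_Y(x)+g(x)$ for all $x\in\mathbb{R}$. Then the function $F_{Y^L}(y)=\min(1,F_Y(y)+g(y))$ is a cumulative distribution function, and a random variable $Y^L$ with CDF $F_{Y^L}$ satisfies $$\mathrm{CVaR}_\alpha(Y^L)\le\mathrm{CVaR}_\alpha(X).$$
   Context: $X$ and $Y$ are real-valued with finite first absolute moment. $F_X(x)=P(X\le x)$. For $\alpha\in(0,1)$, $\mathrm{CVaR}_\alpha(X)=\inf_{w\in\mathbb{R}}\{w+\frac1\alpha\mathbb{E}[(X-w)^+]\}$, with $(x)^+=\max(x,0)$; the same formula defines $\mathrm{CVaR}_\alpha(Y^L)$. *)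

theory Defs
  imports "HOL-Probability.Probability"
begin

definition rv_cdf :: "'a measure \<Rightarrow> ('a \<Rightarrow> real) \<Rightarrow> real \<Rightarrow> real" where
  "rv_cdf M X = cdf (distr M borel X)"

definition is_cdf :: "(real \<Rightarrow> real) \<Rightarrow> bool" where
  "is_cdf F \<longleftrightarrow> (\<exists>D. real_distribution D \<and> cdf D = F)"

text \<open>
  The expectation of the nonnegative variable \<open>(X - w)\<^sup>+\<close> is the Lebesgue integral
  with values in \<open>[0, \<infinity>]\<close>, so that the formula also makes sense for variables that
  are not integrable: in the theorem \<open>Y\<^sup>L\<close> may have expectation \<open>-\<infinity>\<close>,
  as \<open>g\<close> may tend to 0 slowly at \<open>-\<infinity>\<close>.
\<close>

definition CVaR :: "real \<Rightarrow> 'a measure \<Rightarrow> ('a \<Rightarrow> real) \<Rightarrow> ereal" where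
  "CVaR \<alpha> M X =
    (INF w::real. ereal w + ereal (1 / \<alpha>) * enn2ereal (\<integral>\<^sup>+\<omega>. ennreal (max (X \<omega> - w) 0) \<partial>M))"

end

theory Submission
  imports Defs
begin

text \<open>
  Since \<open>F\<^sub>X \<le> 1\<close>, the hypothesis says that \<open>F\<^sub>X\<close> lies below the cdf of \<open>Y\<^sup>L\<close>, so that
  \<open>Y\<^sup>L\<close> has smaller upper tails than \<open>X\<close>. By the layer-cake formula
  \<open>E[(X - w)\<^sup>+]\<close> is the integral of \<open>P(X > t)\<close> over \<open>t > w\<close>, so that each term of the infimum
  defining the CVaR is smaller for \<open>Y\<^sup>L\<close>.
\<close>

text \<open>The excess of x over w is the Lebesgue measure of \<open>{w..<x}\<close>, so Tonelli's
  theorem can swap the two integrals over the region where w \<le> t < \<open>X \<omega>\<close>.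
  Since the integrals take values in [0, \<infinity>], this covers the case of an infinite expected
  excess.\<close>

lemma (in prob_space) nn_integral_excess_eq_tail:
  fixes X :: "'a \<Rightarrow> real"
  assumes X [measurable]: "X \<in> borel_measurable M"
  shows "(\<integral>\<^sup>+\<omega>. ennreal (max (X \<omega> - w) 0) \<partial>M) =
    (\<integral>\<^sup>+t. ennreal (1 - rv_cdf M X t) * indicator {w..} t \<partial>lborel)"
proof -
  interpret P: pair_sigma_finite M lborel ..
  \<comment> \<open>The interval is open at x so that the swap yields the event t <
    \<open>X \<omega>\<close>, the exact complement of the event that the cdf measures; atoms of X
    then need no separate care.\<close>
  have length: "ennreal (max (x - w) 0) = (\<integral>\<^sup>+t. indicator {w..<x} t \<partial>lborel)" for x :: real
    by (cases "w \<le> x") (auto simp: max_def)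
  have tail: "emeasure M {\<omega>\<in>space M. t < X \<omega>} = ennreal (1 - rv_cdf M X t)" for t
  proof -
    have "rv_cdf M X t = prob {\<omega>\<in>space M. X \<omega> \<le> t}"
      unfolding rv_cdf_def cdf_def
      by (subst measure_distr) (auto intro!: arg_cong[where f = prob])
    also have "1 - \<dots> = prob {\<omega>\<in>space M. \<not> X \<omega> \<le> t}"
      by (subst prob_neg) auto
    finally show ?thesis
      by (simp add: emeasure_eq_measure not_le)
  qed
  have "(\<integral>\<^sup>+\<omega>. ennreal (max (X \<omega> - w) 0) \<partial>M) =
      (\<integral>\<^sup>+\<omega>. \<integral>\<^sup>+t. indicator {w..<X \<omega>} t \<partial>lborel \<partial>M)"
    by (simp only: length)
  \<comment> \<open>Written as the indicator of one set of pairs, the integrand is visibly jointly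
    measurable, as the swap requires. Afterwards the constraint w \<le> t does not depend on
    \<open>\<omega>\<close> and leaves the inner integral as a factor.\<close>
  also have "\<dots> = (\<integral>\<^sup>+\<omega>. \<integral>\<^sup>+t. indicator {(\<omega>, t). w \<le> t \<and> t < X \<omega>} (\<omega>, t) \<partial>lborel \<partial>M)"
    by (intro nn_integral_cong) (auto simp: indicator_def)
  also have "\<dots> = (\<integral>\<^sup>+t. \<integral>\<^sup>+\<omega>. indicator {(\<omega>, t). w \<le> t \<and> t < X \<omega>} (\<omega>, t) \<partial>M \<partial>lborel)"
    by (rule P.Fubini'[symmetric]) (simp add: indicator_def case_prod_beta)
  also have "\<dots> = (\<integral>\<^sup>+t. \<integral>\<^sup>+\<omega>. indicator {\<omega>\<in>space M. t < X \<omega>} \<omega> * indicator {w..} t \<partial>M \<partial>lborel)"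
    by (intro nn_integral_cong) (auto simp: indicator_def)
  also have "\<dots> = (\<integral>\<^sup>+t. ennreal (1 - rv_cdf M X t) * indicator {w..} t \<partial>lborel)"
    by (intro nn_integral_cong) (simp add: nn_integral_multc tail)
  finally show ?thesis .
qed

lemma CVaR_antimono_cdf:
  fixes X :: "'a \<Rightarrow> real" and Z :: "'b \<Rightarrow> real"
  assumes "0 \<le> \<alpha>"
    and "prob_space M" and "X \<in> borel_measurable M"
    and "prob_space N" and "Z \<in> borel_measurable N"
    and le: "\<And>x. rv_cdf M X x \<le> rv_cdf N Z x"
  shows "CVaR \<alpha> N Z \<le> CVaR \<alpha> M X"
  unfolding CVaR_def
proof (intro INF_mono)
  fix w :: real
  \<comment> \<open>Both variables may live on different spaces: the layer-cake formula turns both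
    sides into integrals over the same half-line, where the cdfs compare pointwise.\<close>
  have "(\<integral>\<^sup>+\<omega>. ennreal (max (Z \<omega> - w) 0) \<partial>N) \<le> (\<integral>\<^sup>+\<omega>. ennreal (max (X \<omega> - w) 0) \<partial>M)"
    unfolding prob_space.nn_integral_excess_eq_tail[OF assms(2,3)]
      prob_space.nn_integral_excess_eq_tail[OF assms(4,5)]
    by (intro nn_integral_mono mult_right_mono ennreal_leI) (simp_all add: le)
  then have "ereal w + ereal (1 / \<alpha>) * enn2ereal (\<integral>\<^sup>+\<omega>. ennreal (max (Z \<omega> - w) 0) \<partial>N) \<le>
      ereal w + ereal (1 / \<alpha>) * enn2ereal (\<integral>\<^sup>+\<omega>. ennreal (max (X \<omega> - w) 0) \<partial>M)"
    using assms(1) by (intro add_left_mono ereal_mult_left_mono) (auto simp: less_eq_ennreal.rep_eq)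
  then show "\<exists>v\<in>UNIV. ereal v + ereal (1 / \<alpha>) * enn2ereal (\<integral>\<^sup>+\<omega>. ennreal (max (Z \<omega> - v) 0) \<partial>N) \<le>
      ereal w + ereal (1 / \<alpha>) * enn2ereal (\<integral>\<^sup>+\<omega>. ennreal (max (X \<omega> - w) 0) \<partial>M)"
    by blast
qed

text \<open>The witness is the Lebesgue-Stieltjes measure \<open>interval_measure F\<close>. The
  limit 0 at -\<infinity> makes its cdf equal F rather than F plus a constant, and the limit 1 at
  \<infinity> makes its total mass 1.\<close>

lemma is_cdfI:
  assumes "mono F" and "\<And>x. continuous (at_right x) F"
    and "(F \<longlongrightarrow> 0) at_bot" and "(F \<longlongrightarrow> 1) at_top"
  shows "is_cdf F"
  unfolding is_cdf_def
  using assms cdf_interval_measure[of F] real_distribution_interval_measure[of F]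
  by (auto simp: mono_def)

lemma (in real_distribution) is_cdf_min_cdf_plus:
  fixes g :: "real \<Rightarrow> real"
  assumes nonneg: "\<And>x. 0 \<le> g x" and cont: "\<And>x. continuous (at_right x) g"
    and "mono g" and lim: "(g \<longlongrightarrow> 0) at_bot"
  shows "is_cdf (\<lambda>y. min 1 (cdf M y + g y))"
proof (rule is_cdfI)
  show "mono (\<lambda>y. min 1 (cdf M y + g y))"
  proof (rule monoI)
    fix x y :: real
    assume "x \<le> y"
    then have "cdf M x \<le> cdf M y" "g x \<le> g y"
      using cdf_nondecreasing \<open>mono g\<close> by (auto dest: monoD)
    then show "min 1 (cdf M x + g x) \<le> min 1 (cdf M y + g y)"
      by (auto simp: min_def)
  qed
  show "continuous (at_right x) (\<lambda>y. min 1 (cdf M y + g y))" for x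
    using cdf_is_right_cont[of x] cont[of x] by (intro continuous_intros) auto
  have "((\<lambda>y. min 1 (cdf M y + g y)) \<longlongrightarrow> min 1 (0 + 0)) at_bot"
    by (intro tendsto_intros cdf_lim_at_bot lim)
  then show "((\<lambda>y. min 1 (cdf M y + g y)) \<longlongrightarrow> 0) at_bot"
    by simp
  \<comment> \<open>At \<infinity> the function g may converge to any value or be unbounded, so
    limit rules for sums do not apply. The capped sum is instead squeezed between
    \<open>cdf M\<close> and 1; the lower bound uses g \<ge> 0.\<close>
  show "((\<lambda>y. min 1 (cdf M y + g y)) \<longlongrightarrow> 1) at_top"
    by (rule tendsto_sandwich[OF _ _ cdf_lim_at_top_prob tendsto_const])
      (auto simp: cdf_bounded_prob nonneg)
qed

theorem theorem5p3:
  fixes \<alpha> :: real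
    and M :: "'a measure" and X :: "'a \<Rightarrow> real"
    and N :: "'b measure" and Y :: "'b \<Rightarrow> real"
    and g :: "real \<Rightarrow> real"
  assumes "0 < \<alpha>" and "\<alpha> < 1"
    and "prob_space M" and "integrable M X"
    and "prob_space N" and "integrable N Y"
    and "\<And>x. 0 \<le> g x"
    and "\<And>x. continuous (at_right x) g"
    and "mono g"
    and "(g \<longlongrightarrow> 0) at_bot"
    and "\<And>x. rv_cdf M X x \<le> rv_cdf N Y x + g x"
  shows "is_cdf (\<lambda>y. min 1 (rv_cdf N Y y + g y)) \<and>
    (\<forall>(K :: 'c measure) (YL :: 'c \<Rightarrow> real).
      prob_space K \<longrightarrow> YL \<in> borel_measurable K \<longrightarrow>
      rv_cdf K YL = (\<lambda>y. min 1 (rv_cdf N Y y + g y)) \<longrightarrow>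
      CVaR \<alpha> K YL \<le> CVaR \<alpha> M X)"
proof (intro conjI allI impI)
  interpret M: prob_space M by fact
  interpret N: prob_space N by fact
  have X: "X \<in> borel_measurable M" and Y: "Y \<in> borel_measurable N"
    using assms(4,6) by auto
  interpret DX: real_distribution "distr M borel X"
    using X by simp
  interpret DY: real_distribution "distr N borel Y"
    using Y by simp
  show "is_cdf (\<lambda>y. min 1 (rv_cdf N Y y + g y))"
    unfolding rv_cdf_def using assms(7-10) by (rule DY.is_cdf_min_cdf_plus)
  fix K :: "'c measure" and YL :: "'c \<Rightarrow> real"
  assume "prob_space K" "YL \<in> borel_measurable K"
    and "rv_cdf K YL = (\<lambda>y. min 1 (rv_cdf N Y y + g y))"
  \<comment> \<open>With the assumed bound by \<open>rv_cdf N Y x + g x\<close>, this puts the cdf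
    of X below both arguments of the \<open>min\<close>.\<close>
  moreover have "rv_cdf M X x \<le> 1" for x
    unfolding rv_cdf_def by (rule DX.cdf_bounded_prob)
  ultimately show "CVaR \<alpha> K YL \<le> CVaR \<alpha> M X"
    using assms(1,3,11) X by (intro CVaR_antimono_cdf) auto
qed

end
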